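(* There is $m_0\in\mathbb N$ such that for every integer $m\ge m_0$, the function $x\mapsto(-1)^m x^{m-1}R_0^{(m)}(x)$ is not completely monotonic on $(0,+\infty)$.
   Context: A function $f$ is completely monotonic on an interval $I$ if it has derivatives of all orders on $I$ and $(-1)^k f^{(k)}(x)\ge 0$ for all $x\in I$ and all integers $k\ge 0$. For $x>0$, $$R_0(x)=\log\Gamma(x)-\left(x-\tfrac12\right)\log x+x-\tfrac12\log(2\pi),$$ where $\Gamma$ is the classical gamma function, and $R_0^{(m)}$ denotes the $m$-th derivative of $R_0$. *)

theory Defs
  imports "HOL-Analysis.Analysis"
begin

(* The iterated derivatives are two-sided, so this is the usual notion for open intervals I
   (values of f outside I are then irrelevant). Differentiability of every iterate has to be
   required explicitly, because deriv is total. *)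
definition completely_monotonic_on :: "real set \<Rightarrow> (real \<Rightarrow> real) \<Rightarrow> bool" where
  "completely_monotonic_on I f \<longleftrightarrow>
     (\<forall>k. \<forall>x\<in>I. (deriv ^^ k) f differentiable (at x)) \<and>
     (\<forall>k. \<forall>x\<in>I. (-1) ^ k * (deriv ^^ k) f x \<ge> 0)"

(* Remainder in Stirling's formula; only its values at x > 0 are meaningful. *)
definition R0 :: "real \<Rightarrow> real" where
  "R0 x = ln (Gamma x) - (x - 1 / 2) * ln x + x - 1 / 2 * ln (2 * pi)"

end

(* Suppose that f_m(x) = (-1)^m x^(m-1) R0^(m)(x) is completely monotonic for infinitely many m.
   Each f_m extends holomorphically to the right half-plane, and its alternating Taylor coefficients
   at a > 0 make the kernel (i,j) |-> f_m(a - r cis(t_i - t_j)) positive semidefinite for r < a.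
   Since f_m(m z) m/(m-1)! tends to H(z) = 1/(z (1 - exp(-1/z))) - 1 - 1/(2z), the same holds for H;
   letting a tend to infinity with r = a - y and angles t_i/a, the kernel H(y - i(t_i - t_j)) is
   positive semidefinite for every y > 0. As y tends to 0, y H(y - i s) converges to 1/2 for s = 0,
   to i s if s = 1/(2 pi k) with k a nonzero integer, and to 0 otherwise. Testing this limit kernel
   against the characters cis(j pi/24) at the points j/(24 pi), j < N, and averaging as N grows would imply
   sin(pi/2) + sin(pi/4)/2 + sin(pi/6)/3 + sin(pi/8)/4 <= pi/2, which is false. *)
theory Submission
  imports Defs "HOL-Complex_Analysis.Complex_Analysis" "HOL-Real_Asymp.Real_Asymp"
begin

(* For x > 0 this is (-1)^m x^(m-1) R0^(m)(x) with m = n + 2, which avoids truncated subtraction. *)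
definition R0_transform :: "nat \<Rightarrow> 'a :: {real_normed_field,banach} \<Rightarrow> 'a" where
  "R0_transform n z = (-1) ^ n * z ^ (n + 1) * Polygamma (n + 1) z - fact n - fact (n + 1) / (2 * z)"

section \<open>Derivatives of \<open>R0\<close> in terms of polygamma functions\<close>

lemma deriv_R0_eq:
  assumes "x > 0"
  shows "deriv R0 x = Digamma x - ln x + 1 / (2 * x)"
proof -
  have x: "x \<notin> \<int>\<^sub>\<le>\<^sub>0"
    using assms by (auto elim!: nonpos_Ints_cases)
  have g: "((\<lambda>x. ln_Gamma x - (x - 1 / 2) * ln x + x - 1 / 2 * ln (2 * pi))
      has_real_derivative (Digamma x - ln x + 1 / (2 * x))) (at x)"
    using assms by (auto intro!: derivative_eq_intros simp: field_simps)
  have "eventually (\<lambda>y. y > 0) (nhds x)"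
    using assms by (intro eventually_nhds_in_open[of "{0<..}", simplified]) auto
  then have "eventually (\<lambda>y. R0 y = ln_Gamma y - (y - 1 / 2) * ln y + y - 1 / 2 * ln (2 * pi)) (nhds x)"
    by eventually_elim (simp add: R0_def ln_Gamma_real_pos)
  with g have "(R0 has_real_derivative (Digamma x - ln x + 1 / (2 * x))) (at x)"
    by (subst DERIV_cong_ev) auto
  then show ?thesis by (rule DERIV_imp_deriv)
qed

text \<open>From the second derivative on, the logarithm has turned into a negative power, so the
  induction can start there: each further differentiation raises the polygamma order and both
  exponents by one.\<close>

lemma higher_deriv_R0:
  assumes "x > 0"
  shows "(deriv ^^ (n + 2)) R0 x = (-1) ^ n * R0_transform n x / x ^ (n + 1)"
proof -
  let ?D = "\<lambda>n x :: real. Polygamma (n + 1) x - (-1) ^ n * fact n / x ^ (n + 1)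
              - (-1) ^ n * fact (n + 1) / (2 * x ^ (n + 2))"
  have pos: "eventually (\<lambda>y. y > 0) (nhds x)" if "x > 0" for x :: real
    using that by (intro eventually_nhds_in_open[of "{0<..}", simplified]) auto
  have D: "(deriv ^^ (n + 2)) R0 x = ?D n x" if "x > 0" for x
    using that
  proof (induction n arbitrary: x)
    case 0
    have "x \<notin> \<int>\<^sub>\<le>\<^sub>0"
      using 0 by (auto elim!: nonpos_Ints_cases)
    then have "((\<lambda>x. Digamma x - ln x + 1 / (2 * x)) has_real_derivative ?D 0 x) (at x)"
      using 0 by (auto intro!: derivative_eq_intros simp: field_simps power2_eq_square)
    moreover have "eventually (\<lambda>y. deriv R0 y = Digamma y - ln y + 1 / (2 * y)) (nhds x)"
      using pos[OF 0] by eventually_elim (rule deriv_R0_eq)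
    ultimately have "(deriv R0 has_real_derivative ?D 0 x) (at x)"
      by (subst DERIV_cong_ev) auto
    then show ?case by (simp add: DERIV_imp_deriv numeral_2_eq_2)
  next
    case (Suc n)
    have "x \<notin> \<int>\<^sub>\<le>\<^sub>0"
      using Suc.prems by (auto elim!: nonpos_Ints_cases)
    then have 1: "((\<lambda>x. Polygamma (n + 1) x) has_real_derivative Polygamma (Suc n + 1) x) (at x)"
      using has_field_derivative_Polygamma[of x "n + 1" UNIV] by simp
    have 2: "((\<lambda>x. c / x ^ Suc k) has_real_derivative - (real (Suc k) * c) / x ^ Suc (Suc k)) (at x)" for c k
      using DERIV_divide[OF DERIV_const[of c] DERIV_pow[of "Suc k" x UNIV]] Suc.prems by (simp add: mult_ac)
    have "(?D n has_real_derivative ?D (Suc n) x) (at x)"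
      using DERIV_diff[OF DERIV_diff[OF 1 2[of "(-1) ^ n * fact n" n]]
          2[of "(-1) ^ n * fact (n + 1) / 2" "n + 1"]]
      by (simp add: mult_ac add_ac)
    moreover have "eventually (\<lambda>y. (deriv ^^ (n + 2)) R0 y = ?D n y) (nhds x)"
      using pos[OF Suc.prems] by eventually_elim (rule Suc.IH)
    ultimately have "((deriv ^^ (n + 2)) R0 has_real_derivative ?D (Suc n) x) (at x)"
      by (subst DERIV_cong_ev) auto
    then show ?case by (simp add: DERIV_imp_deriv)
  qed
  have "?D n x = (-1) ^ n * R0_transform n x / x ^ (n + 1)"
    using assms by (cases "even n") (simp_all add: R0_transform_def diff_divide_distrib add_divide_distrib)
  with D[OF assms] show ?thesis by simp
qed

lemma R0_transform_eq:
  assumes "x > 0"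
  shows "(-1) ^ (n + 2) * x powi (int (n + 2) - 1) * (deriv ^^ (n + 2)) R0 x = R0_transform n x"
proof -
  have "x powi (int (n + 2) - 1) = x ^ (n + 1)"
    using power_int_of_nat[of x "n + 1"] by (simp add: add_ac)
  then show ?thesis
    unfolding higher_deriv_R0[OF assms] using assms
    by (cases "even n") simp_all
qed

lemma R0_transform_of_real: "x \<noteq> 0 \<Longrightarrow> R0_transform n (of_real x) = of_real (R0_transform n x)"
  by (simp add: R0_transform_def Polygamma_of_real)

lemma holomorphic_R0_transform: "R0_transform n holomorphic_on {z. Re z > 0}"
proof -
  have "{z. Re z > 0} \<inter> \<int>\<^sub>\<le>\<^sub>0 = {}"
    by (auto elim!: nonpos_Ints_cases)
  then show ?thesis
    unfolding R0_transform_def by (intro holomorphic_intros) auto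
qed

section \<open>From complete monotonicity to positive semidefinite kernels\<close>

text \<open>Both sides are the derivative at \<open>x\<close> of the same curve
  \<open>y \<mapsto> f (of_real y)\<close>, and vector derivatives are unique.\<close>

lemma deriv_of_real_eq:
  fixes f :: "complex \<Rightarrow> complex" and g :: "real \<Rightarrow> real"
  assumes f: "f field_differentiable (at (of_real x))" and g: "g differentiable (at x)"
    and S: "open S" "x \<in> S" and eq: "\<And>y. y \<in> S \<Longrightarrow> f (of_real y) = of_real (g y)"
  shows "deriv f (of_real x) = of_real (deriv g x)"
proof -
  have "((\<lambda>y. f (of_real y)) has_vector_derivative deriv f (of_real x)) (at x)"
    using f by (intro has_vector_derivative_real_field) (simp add: field_differentiable_derivI)
  moreover have "(g has_real_derivative deriv g x) (at x)"
    using g by (simp add: DERIV_deriv_iff_real_differentiable)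
  then have "((\<lambda>y. of_real (g y) :: complex) has_vector_derivative of_real (deriv g x)) (at x)"
    by (intro has_vector_derivative_of_real) (simp add: has_real_derivative_iff_has_vector_derivative)
  then have "((\<lambda>y. f (of_real y)) has_vector_derivative of_real (deriv g x)) (at x)"
    by (rule has_vector_derivative_transform_within_open[OF _ S]) (simp add: eq)
  ultimately show ?thesis
    by (rule vector_derivative_unique_at)
qed

(* The Taylor coefficients of f at a alternate in sign, so f (a - u) is a power series in u with
   nonnegative coefficients, and u = cis (t i) * cnj (cis (t j)) makes each power a Gram matrix. *)
lemma completely_monotonic_positive_definite:
  fixes f :: "complex \<Rightarrow> complex" and g :: "real \<Rightarrow> real" and t :: "'i \<Rightarrow> real"
  assumes cm: "completely_monotonic_on {0<..} g"
    and hol: "f holomorphic_on {z. Re z > 0}"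
    and eq: "\<And>x. x > 0 \<Longrightarrow> f (of_real x) = of_real (g x)"
    and r: "0 \<le> r" "r < a"
  shows "0 \<le> Re (\<Sum>i\<in>I. \<Sum>j\<in>I. c i * cnj (c j) * f (of_real a - of_real r * cis (t i - t j)))"
proof -
  have op: "open {z. Re z > 0}"
    by (simp add: open_halfspace_Re_gt)
  have D: "(deriv ^^ n) f (of_real x) = of_real ((deriv ^^ n) g x)" if "x > 0" for n x
    using that
  proof (induction n arbitrary: x)
    case (Suc n)
    have "(deriv ^^ n) f holomorphic_on {z. Re z > 0}"
      using hol op by (rule holomorphic_higher_deriv)
    then have 1: "(deriv ^^ n) f field_differentiable (at (of_real x))"
      using op Suc.prems by (auto simp: holomorphic_on_open field_differentiable_def)
    have 2: "(deriv ^^ n) g differentiable (at x)"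
      using cm Suc.prems by (auto simp: completely_monotonic_on_def)
    show ?case
      using deriv_of_real_eq[OF 1 2, of "{0<..}"] Suc by simp
  qed (simp add: eq)
  define C where "C n = (-1) ^ n * (deriv ^^ n) g a / fact n * r ^ n" for n
  have C: "C n \<ge> 0" for n
    using cm r by (auto simp: C_def completely_monotonic_on_def intro!: mult_nonneg_nonneg divide_nonneg_pos)
  have sm: "(\<lambda>n. of_real (C n) * cis s ^ n) sums f (of_real a - of_real r * cis s)" for s
  proof -
    \<comment> \<open>The Taylor series of \<open>f\<close> at \<open>a\<close> converges in the
      disc of radius \<open>a\<close>, which stays in the half-plane; the point in question has
      distance \<open>r < a\<close> from the centre.\<close>
    have "ball (of_real a) a \<subseteq> {z. Re z > 0}"
    proof
      fix z assume "z \<in> ball (complex_of_real a) a"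
      then have "cmod (of_real a - z) < a" by (simp add: dist_norm)
      with complex_Re_le_cmod[of "of_real a - z"] show "z \<in> {z. Re z > 0}" by simp
    qed
    with hol have "f holomorphic_on ball (of_real a) a" by (rule holomorphic_on_subset)
    moreover have "of_real a - of_real r * cis s \<in> ball (of_real a) a"
      using r by (simp add: dist_norm norm_mult)
    ultimately have "(\<lambda>n. (deriv ^^ n) f (of_real a) / fact n * (of_real a - of_real r * cis s - of_real a) ^ n)
        sums f (of_real a - of_real r * cis s)"
      by (rule holomorphic_power_series)
    moreover have "(deriv ^^ n) f (of_real a) / fact n * (of_real a - of_real r * cis s - of_real a) ^ n
        = of_real (C n) * cis s ^ n" for n
    proof -
      have "of_real a - of_real r * cis s - of_real a = (-1) * of_real r * cis s" by simp
      then have "(of_real a - of_real r * cis s - of_real a) ^ n = (-1) ^ n * of_real (r ^ n) * cis s ^ n"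
        by (simp only: power_mult_distrib of_real_power)
      moreover have "a > 0" using r by simp
      ultimately show ?thesis
        by (simp add: D C_def)
    qed
    ultimately show ?thesis by simp
  qed
  have "(\<lambda>n. \<Sum>i\<in>I. \<Sum>j\<in>I. c i * cnj (c j) * (of_real (C n) * cis (t i - t j) ^ n)) sums
      (\<Sum>i\<in>I. \<Sum>j\<in>I. c i * cnj (c j) * f (of_real a - of_real r * cis (t i - t j)))"
    by (intro sums_sum sums_mult sm)
  also have "(\<lambda>n. \<Sum>i\<in>I. \<Sum>j\<in>I. c i * cnj (c j) * (of_real (C n) * cis (t i - t j) ^ n)) =
      (\<lambda>n. of_real (C n * (cmod (\<Sum>i\<in>I. c i * cis (t i) ^ n))\<^sup>2))"
  proof
    fix n
    have 1: "cis (t i - t j) ^ n = cis (t i) ^ n * cnj (cis (t j) ^ n)" for i j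
      by (simp add: cis_cnj cis_mult flip: power_mult_distrib)
    have "(\<Sum>i\<in>I. \<Sum>j\<in>I. c i * cnj (c j) * (of_real (C n) * cis (t i - t j) ^ n)) =
        (\<Sum>i\<in>I. \<Sum>j\<in>I. of_real (C n) * ((c i * cis (t i) ^ n) * cnj (c j * cis (t j) ^ n)))"
      unfolding 1 by (simp add: mult_ac)
    also have "\<dots> = of_real (C n) * ((\<Sum>i\<in>I. c i * cis (t i) ^ n) * cnj (\<Sum>i\<in>I. c i * cis (t i) ^ n))"
      by (simp only: cnj_sum sum_product) (simp only: sum_distrib_left)
    finally show "(\<Sum>i\<in>I. \<Sum>j\<in>I. c i * cnj (c j) * (of_real (C n) * cis (t i - t j) ^ n)) =
        of_real (C n * (cmod (\<Sum>i\<in>I. c i * cis (t i) ^ n))\<^sup>2)"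
      by (simp only: of_real_mult complex_norm_square)
  qed
  finally have "(\<lambda>n. Re (of_real (C n * (cmod (\<Sum>i\<in>I. c i * cis (t i) ^ n))\<^sup>2))) sums
      Re (\<Sum>i\<in>I. \<Sum>j\<in>I. c i * cnj (c j) * f (of_real a - of_real r * cis (t i - t j)))"
    by (rule sums_Re)
  then show ?thesis
    by (rule sums_le[OF _ sums_zero, rotated]) (simp add: C)
qed

section \<open>The scaling limit of the transforms\<close>

text \<open>With w = 1/z this is (w/2) coth(w/2) - 1, the exponential generating function of the
  Bernoulli numbers of index at least 2. Its poles z = 1/(2 pi i k), k a nonzero integer, accumulate
  at 0 along the imaginary axis.\<close>

definition R0_limit :: "complex \<Rightarrow> complex" where
  "R0_limit z = 1 / z / (1 - exp (- 1 / z)) - 1 - 1 / (2 * z)"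

text \<open>The derivative of Ln(1 + w h) at h = 0 is w; put h = 1/(n + 2) and exponentiate.\<close>

lemma tendsto_exp_limit_complex:
  fixes w :: complex
  shows "(\<lambda>n. (1 + w / of_nat (n + 2)) ^ (n + 2)) \<longlonglongrightarrow> exp w"
proof -
  have lim: "filterlim (\<lambda>n. of_nat (n + 2) :: complex) at_infinity sequentially"
    by (intro filterlim_compose[OF tendsto_of_nat] filterlim_add_const_nat_at_top)
  then have to0: "(\<lambda>n. w / of_nat (n + 2)) \<longlonglongrightarrow> 0"
    by (intro tendsto_divide_0[OF tendsto_const])
  have "((\<lambda>h. Ln (1 + w * h)) has_field_derivative w) (at 0)"
    by (auto intro!: derivative_eq_intros)
  then have "((\<lambda>h. Ln (1 + w * h) / h) \<longlongrightarrow> w) (at 0)"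
    by (simp add: DERIV_def)
  moreover have "filterlim (\<lambda>n. 1 / of_nat (n + 2) :: complex) (at 0) sequentially"
  proof (intro filterlim_atI tendsto_divide_0[OF tendsto_const] lim always_eventually allI)
    fix n
    have "of_nat (n + 2) \<noteq> (0 :: complex)"
      unfolding of_nat_eq_0_iff by simp
    then show "1 / of_nat (n + 2) \<noteq> (0 :: complex)"
      by (metis divide_eq_0_iff one_neq_zero)
  qed
  ultimately have "(\<lambda>n. Ln (1 + w * (1 / of_nat (n + 2))) / (1 / of_nat (n + 2))) \<longlonglongrightarrow> w"
    by (rule filterlim_compose)
  then have "(\<lambda>n. exp (of_nat (n + 2) * Ln (1 + w / of_nat (n + 2)))) \<longlonglongrightarrow> exp w"
    by (intro tendsto_exp) (simp add: mult.commute)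
  moreover have "eventually (\<lambda>n. exp (of_nat (n + 2) * Ln (1 + w / of_nat (n + 2))) =
      (1 + w / of_nat (n + 2)) ^ (n + 2)) sequentially"
  proof -
    have "(\<lambda>n. 1 + w / of_nat (n + 2)) \<longlonglongrightarrow> 1 + 0"
      by (intro tendsto_intros to0)
    then have "eventually (\<lambda>n. 1 + w / of_nat (n + 2) \<noteq> 0) sequentially"
      by (rule tendsto_imp_eventually_ne) simp
    then show ?thesis
      by eventually_elim (subst exp_of_nat_mult, subst exp_Ln, auto)
  qed
  ultimately show ?thesis
    by (rule Lim_transform_eventually)
qed

text \<open>Serves to dominate a series over k uniformly in n, with y proportional to k: the
  reciprocals of the left side are then summable, while the linear bound of Bernoulli's inequality
  would only give a harmonic series. Equality at n = 0 starts the induction.\<close>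

lemma power_ge_square:
  fixes y :: real
  assumes "y \<ge> 0"
  shows "(1 + real (n + 2) * y / 2)\<^sup>2 \<le> (1 + y) ^ (n + 2)"
proof (induction n)
  case (Suc n)
  have "(1 + real (Suc n + 2) * y / 2)\<^sup>2 \<le> (1 + real (n + 2) * y / 2)\<^sup>2 * (1 + y)"
  proof -
    have "(1 + real (n + 2) * y / 2)\<^sup>2 * (1 + y) - (1 + real (Suc n + 2) * y / 2)\<^sup>2 =
        y\<^sup>2 * (2 * real n + 3) / 4 + (real n + 2)\<^sup>2 * y ^ 3 / 4"
      by (simp add: field_simps power2_eq_square power3_eq_cube)
    also have "\<dots> \<ge> 0"
      using assms by simp
    finally show ?thesis by simp
  qed
  also have "\<dots> \<le> (1 + y) ^ (n + 2) * (1 + y)"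
    using Suc assms by (intro mult_right_mono) auto
  finally show ?case by (simp add: mult_ac)
qed (simp add: power2_eq_square)

text \<open>With m = n + 2 and w = 1/z, the polygamma series turns the leading term into (1/z) times
  the sum over k of (1 + k w/m)^(-m). Tannery's theorem lets m grow termwise, leaving the geometric
  series of exp(-w); the other two terms become m/(m-1) and 1/(2z).\<close>

lemma R0_transform_scaled_limit:
  assumes z: "Re z > 0"
  shows "(\<lambda>n. of_nat (n + 2) / fact (n + 1) * R0_transform n (of_nat (n + 2) * z)) \<longlonglongrightarrow> R0_limit z"
proof -
  define w where "w = 1 / z"
  have z0: "z \<noteq> 0" using z by auto
  have w: "Re w > 0" using z by (simp add: w_def Re_divide power2_eq_square sum_squares_gt_zero_iff)
  define a where "a k n = inverse ((1 + of_nat k * w / of_nat (n + 2)) ^ (n + 2))" for k n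
  define M where "M k = inverse ((1 + real k * Re w / 2)\<^sup>2)" for k
  have lim: "(\<lambda>n. a k n) \<longlonglongrightarrow> exp (- w) ^ k" for k
  proof -
    have "(\<lambda>n. a k n) \<longlonglongrightarrow> inverse (exp (of_nat k * w))"
      unfolding a_def by (intro tendsto_inverse tendsto_exp_limit_complex) auto
    then show ?thesis by (simp add: exp_minus exp_of_nat_mult power_inverse)
  qed
  have bound: "norm (a k n) \<le> M k" for k n
  proof -
    define y where "y = real k * Re w / real (n + 2)"
    have y: "y \<ge> 0" using w by (simp add: y_def)
    have "real (n + 2) * y = real k * Re w" by (simp add: y_def)
    then have "(1 + real k * Re w / 2)\<^sup>2 \<le> (1 + y) ^ (n + 2)"
      using power_ge_square[OF y, of n] by simp
    also have "1 + y = Re (1 + of_nat k * w / of_nat (n + 2))"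
      by (simp add: y_def Re_divide_of_nat)
    also have "\<dots> ^ (n + 2) \<le> cmod (1 + of_nat k * w / of_nat (n + 2)) ^ (n + 2)"
      using y by (intro power_mono complex_Re_le_cmod) (simp add: y_def Re_divide_of_nat)
    finally have "(1 + real k * Re w / 2)\<^sup>2 \<le> norm ((1 + of_nat k * w / of_nat (n + 2)) ^ (n + 2))"
      by (simp only: norm_power)
    moreover have "0 < 1 + real k * Re w / 2"
      using w by (intro add_pos_nonneg) auto
    ultimately show ?thesis
      unfolding a_def M_def norm_inverse by (intro le_imp_inverse_le) auto
  qed
  have "summable M"
  proof -
    \<comment> \<open>\<open>M k\<close> is a constant multiple of the inverse square of 2 / Re w +
      k, so the trigamma series at 2 / Re w gives summability.\<close>
    have "summable (\<lambda>k. (2 / Re w)\<^sup>2 * inverse ((2 / Re w + of_nat k)\<^sup>2))"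
      using w by (intro summable_mult Polygamma_converges') auto
    moreover have "(2 / Re w)\<^sup>2 * inverse ((2 / Re w + of_nat k)\<^sup>2) = M k" for k
    proof -
      have "2 / Re w + of_nat k = 2 / Re w * (1 + real k * Re w / 2)"
        using w by (simp add: field_simps)
      then show ?thesis
        using w unfolding M_def by (simp only: power_mult_distrib) simp
    qed
    ultimately show ?thesis by simp
  qed
  then have "(\<lambda>n. \<Sum>k. a k n) \<longlonglongrightarrow> (\<Sum>k. exp (- w) ^ k)"
    using tannerys_theorem[where a = a and M = M, OF lim always_eventually _ sequentially_bot] bound
    by auto
  also have "(\<Sum>k. exp (- w) ^ k) = 1 / (1 - exp (- w))"
    using w by (intro suminf_geometric) simp
  finally have 1: "(\<lambda>n. \<Sum>k. a k n) \<longlonglongrightarrow> 1 / (1 - exp (- w))" .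
  have 2: "(\<lambda>n. real (n + 2) / real (n + 1)) \<longlonglongrightarrow> 1"
    by real_asymp
  have 2: "(\<lambda>n. of_nat (n + 2) / of_nat (n + 1) :: complex) \<longlonglongrightarrow> 1"
    using tendsto_of_real[OF 2, where 'a = complex] by (simp del: of_nat_add of_nat_Suc)
  have "(\<lambda>n. 1 / z * (\<Sum>k. a k n) - of_nat (n + 2) / of_nat (n + 1) - 1 / (2 * z)) \<longlonglongrightarrow>
      1 / z * (1 / (1 - exp (- w))) - 1 - 1 / (2 * z)"
    by (intro tendsto_intros 1 2)
  moreover have "1 / z * (\<Sum>k. a k n) - of_nat (n + 2) / of_nat (n + 1) - 1 / (2 * z) =
      of_nat (n + 2) / fact (n + 1) * R0_transform n (of_nat (n + 2) * z)" for n
  proof -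
    define m :: complex where "m = of_nat (n + 2)"
    have m: "m \<noteq> 0" unfolding m_def of_nat_eq_0_iff by simp
    have mz: "m * z \<noteq> 0" using m z0 by simp
    have cancel: "u ^ p * inverse ((u * v) ^ p) = inverse (v ^ p)" if "u \<noteq> 0" for u v :: complex and p
      using that by (simp add: power_mult_distrib)
    have "(\<lambda>k. inverse ((m * z + of_nat k) ^ (n + 2))) sums ((-1) ^ n * Polygamma (n + 1) (m * z) / fact (n + 1))"
      using Polygamma_LIMSEQ[OF mz, of "n + 1"] by simp
    then have "(\<lambda>k. (m * z) ^ (n + 2) * inverse ((m * z + of_nat k) ^ (n + 2))) sums
        ((m * z) ^ (n + 2) * ((-1) ^ n * Polygamma (n + 1) (m * z) / fact (n + 1)))"
      by (rule sums_mult)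
    also have "(\<lambda>k. (m * z) ^ (n + 2) * inverse ((m * z + of_nat k) ^ (n + 2))) = (\<lambda>k. a k n)"
    proof
      fix k
      have "m * z + of_nat k = m * z * (1 + of_nat k * w / m)"
        using m z0 by (simp add: w_def field_simps)
      then show "(m * z) ^ (n + 2) * inverse ((m * z + of_nat k) ^ (n + 2)) = a k n"
        unfolding a_def m_def[symmetric] by (simp only: cancel[OF mz])
    qed
    finally have S: "(\<Sum>k. a k n) = (m * z) ^ (n + 2) * ((-1) ^ n * Polygamma (n + 1) (m * z) / fact (n + 1))"
      by (simp add: sums_iff)
    have f: "fact (n + 1) = of_nat (n + 1) * (fact n :: complex)" by (simp add: mult.commute)
    have "1 / z * (\<Sum>k. a k n) = m * (m * z) ^ (n + 1) * ((-1) ^ n * Polygamma (n + 1) (m * z)) / fact (n + 1)"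
      unfolding S using z0 by simp
    moreover have "m / of_nat (n + 1) = m * fact n / fact (n + 1)"
      unfolding f by simp
    moreover have "1 / (2 * z) = m * (fact (n + 1) / (2 * (m * z))) / fact (n + 1)"
      using m by (simp del: fact_Suc)
    ultimately show ?thesis
      unfolding R0_transform_def m_def[symmetric]
      by (simp only: right_diff_distrib diff_divide_distrib) (simp add: mult_ac)
  qed
  ultimately show ?thesis
    by (simp add: R0_limit_def w_def)
qed

section \<open>Behaviour of \<open>R0_limit\<close> near the imaginary axis\<close>

lemma isCont_R0_limit:
  assumes "z \<noteq> 0" "exp (- 1 / z) \<noteq> 1"
  shows "isCont R0_limit z"
  unfolding R0_limit_def using assms by (intro continuous_intros) auto

lemma exp_inverse_neq_1:
  assumes "Re z > 0"
  shows "exp (- 1 / z) \<noteq> 1"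
proof -
  have "Re (1 / z) > 0"
    using assms by (simp add: Re_divide power2_eq_square sum_squares_gt_zero_iff)
  then have "Re (- 1 / z) < 0"
    by simp
  then have "cmod (exp (- 1 / z)) < 1"
    by (simp only: norm_exp_eq_Re exp_less_one_iff)
  then show ?thesis by (metis norm_one less_irrefl)
qed

text \<open>The circle with centre a and radius a - y passes through y and flattens to a vertical
  line as a grows. With h = 1/a the expression is y cis(s h) minus the difference quotient of cis(s
  h) at h = 0.\<close>

lemma tendsto_rotation:
  "((\<lambda>a. of_real a - of_real (a - y) * cis (s / a)) \<longlongrightarrow> of_real y - \<i> * of_real s) at_top"
proof -
  have "((\<lambda>h. exp (\<i> * (of_real s * h))) has_field_derivative \<i> * of_real s) (at 0)"
    by (auto intro!: derivative_eq_intros)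
  then have 1: "((\<lambda>h. (exp (\<i> * (of_real s * h)) - 1) / h) \<longlongrightarrow> \<i> * of_real s) (at 0)"
    by (simp add: DERIV_def)
  have "((\<lambda>a. inverse a) \<longlongrightarrow> (0 :: real)) at_top"
    by real_asymp
  from tendsto_of_real[OF this, where 'a = complex] have 2: "filterlim (\<lambda>a. complex_of_real (inverse a)) (at 0) at_top"
    by (intro filterlim_atI) (auto intro: eventually_mono[OF eventually_gt_at_top[of 0]])
  have 3: "((\<lambda>a. (cis (s * inverse a) - 1) / of_real (inverse a)) \<longlongrightarrow> \<i> * of_real s) at_top"
    using filterlim_compose[OF 1 2] by (simp add: cis_conv_exp)
  have 4: "((\<lambda>a. cis (s * inverse a)) \<longlongrightarrow> 1) at_top"
  proof -
    have "((\<lambda>a. s * inverse a) \<longlongrightarrow> 0) at_top" by real_asymp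
    then have "((\<lambda>a. cis (s * inverse a)) \<longlongrightarrow> cis 0) at_top"
      by (intro tendsto_cis)
    then show ?thesis by simp
  qed
  have "((\<lambda>a. of_real y * cis (s * inverse a) - (cis (s * inverse a) - 1) / of_real (inverse a))
      \<longlongrightarrow> of_real y * 1 - \<i> * of_real s) at_top"
    by (intro tendsto_intros 3 4)
  moreover have "eventually (\<lambda>a. of_real y * cis (s * inverse a) - (cis (s * inverse a) - 1) / of_real (inverse a) =
      of_real a - of_real (a - y) * cis (s / a)) at_top"
    using eventually_gt_at_top[of 0]
    by eventually_elim (simp add: field_simps)
  ultimately show ?thesis
    by (simp add: Lim_transform_eventually)
qed

lemma R0_limit_at_0: "((\<lambda>y. of_real y * R0_limit (of_real y)) \<longlongrightarrow> 1 / 2) (at_right 0)"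
proof -
  have "((\<lambda>y::real. 1 / (1 - exp (- 1 / y)) - y - 1 / 2) \<longlongrightarrow> 1 / 2) (at_right 0)"
    by real_asymp
  then have "((\<lambda>y::real. complex_of_real (1 / (1 - exp (- 1 / y)) - y - 1 / 2)) \<longlongrightarrow> of_real (1 / 2)) (at_right 0)"
    by (rule tendsto_of_real)
  moreover have "eventually (\<lambda>y. complex_of_real (1 / (1 - exp (- 1 / y)) - y - 1 / 2) =
      of_real y * R0_limit (of_real y)) (at_right 0)"
    using eventually_at_right_less[of 0]
  proof eventually_elim
    case (elim y)
    have "of_real y * (1 / of_real y / c - 1 - 1 / (2 * of_real y)) = 1 / c - of_real y - 1 / 2" for c :: complex
      using elim by (simp add: right_diff_distrib)
    then show ?case
      by (simp add: R0_limit_def flip: exp_of_real)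
  qed
  ultimately show ?thesis
    by (simp add: Lim_transform_eventually)
qed

text \<open>The limit is the residue at the simple pole z0 = -i s: the numerator 1/z0 over the
  derivative -1/z0^2 of 1 - exp(-1/z), which gives -z0 = i s.\<close>

lemma R0_limit_at_pole:
  assumes s: "s \<noteq> 0" and e: "exp (- \<i> / of_real s) = 1"
  shows "((\<lambda>y. of_real y * R0_limit (of_real y - \<i> * of_real s)) \<longlongrightarrow> \<i> * of_real s) (at_right 0)"
proof -
  define z0 where "z0 = - \<i> * complex_of_real s"
  have "- 1 / z0 = - \<i> / of_real s"
    using s by (simp add: z0_def field_simps)
  then have z0: "z0 \<noteq> 0" "exp (- 1 / z0) = 1"
    using s e by (simp add: z0_def, metis)
  have "((\<lambda>h. 1 - exp (- 1 / (z0 + h))) has_field_derivative - 1 / z0\<^sup>2) (at 0)"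
    using z0 by (auto intro!: derivative_eq_intros simp: power2_eq_square)
  then have "((\<lambda>h. (1 - exp (- 1 / (z0 + h))) / h) \<longlongrightarrow> - 1 / z0\<^sup>2) (at 0)"
    using z0 by (simp add: DERIV_def)
  moreover have "filterlim complex_of_real (at 0) (at_right 0)"
    by (intro filterlim_atI) (auto intro!: tendsto_eq_intros simp: eventually_at_filter)
  ultimately have 1: "((\<lambda>y. (1 - exp (- 1 / (z0 + of_real y))) / of_real y) \<longlongrightarrow> - 1 / z0\<^sup>2) (at_right 0)"
    by (rule filterlim_compose)
  have 2: "((\<lambda>y. complex_of_real y) \<longlongrightarrow> 0) (at_right 0)"
    by (auto intro!: tendsto_eq_intros)
  have "((\<lambda>y. 1 / (z0 + of_real y) / ((1 - exp (- 1 / (z0 + of_real y))) / of_real y) - of_real y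
        - of_real y / (2 * (z0 + of_real y)))
      \<longlongrightarrow> 1 / (z0 + 0) / (- 1 / z0\<^sup>2) - 0 - 0 / (2 * (z0 + 0))) (at_right 0)"
    using z0 by (intro tendsto_intros 1 2) auto
  also have "1 / (z0 + 0) / (- 1 / z0\<^sup>2) - 0 - 0 / (2 * (z0 + 0)) = \<i> * of_real s"
    using z0(1) by (simp add: power2_eq_square) (simp add: z0_def)
  also have "(\<lambda>y. 1 / (z0 + of_real y) / ((1 - exp (- 1 / (z0 + of_real y))) / of_real y) - of_real y
        - of_real y / (2 * (z0 + of_real y))) = (\<lambda>y. of_real y * R0_limit (of_real y - \<i> * of_real s))"
    by (simp add: R0_limit_def z0_def right_diff_distrib add.commute fun_eq_iff)
  finally show ?thesis .
qed

lemma R0_limit_at_regular_point: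
  assumes s: "s \<noteq> 0" and e: "exp (- \<i> / of_real s) \<noteq> 1"
  shows "((\<lambda>y. of_real y * R0_limit (of_real y - \<i> * of_real s)) \<longlongrightarrow> 0) (at_right 0)"
proof -
  define z0 where "z0 = - \<i> * complex_of_real s"
  have "- 1 / z0 = - \<i> / of_real s"
    using s by (simp add: z0_def field_simps)
  then have z0: "z0 \<noteq> 0" "exp (- 1 / z0) \<noteq> 1"
    using s e by (simp add: z0_def, metis)
  have 2: "((\<lambda>y. complex_of_real y) \<longlongrightarrow> 0) (at_right 0)"
    by (auto intro!: tendsto_eq_intros)
  have "((\<lambda>y. of_real y - \<i> * of_real s) \<longlongrightarrow> z0) (at_right 0)"
    unfolding z0_def by (auto intro!: tendsto_eq_intros)
  then have "((\<lambda>y. R0_limit (of_real y - \<i> * of_real s)) \<longlongrightarrow> R0_limit z0) (at_right 0)"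
    by (rule isCont_tendsto_compose[OF isCont_R0_limit[OF z0]])
  from tendsto_mult[OF 2 this] show ?thesis by simp
qed

section \<open>Positive semidefiniteness of the limit kernels\<close>

lemma R0_limit_positive_definite_circle:
  assumes freq: "\<exists>\<^sub>F n in sequentially. completely_monotonic_on {0<..} (G n)"
    and G: "\<And>n x. x > 0 \<Longrightarrow> G n x = R0_transform n x"
    and r: "0 \<le> r" "r < a"
  shows "0 \<le> Re (\<Sum>i\<in>I. \<Sum>j\<in>I. c i * cnj (c j) * R0_limit (of_real a - of_real r * cis (t i - t j)))"
    (is "0 \<le> Re ?L")
proof -
  define z where "z i j = of_real a - of_real r * cis (t i - t j)" for i j
  define k where "k n = of_nat (n + 2) / (fact (n + 1) :: real)" for n
  define S where "S n = (\<Sum>i\<in>I. \<Sum>j\<in>I. c i * cnj (c j) * (of_real (k n) * R0_transform n (of_nat (n + 2) * z i j)))" for n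
  have z: "Re (z i j) > 0" for i j
  proof -
    have "r * cos (t i - t j) \<le> r * 1"
      using r by (intro mult_left_mono) auto
    then show ?thesis
      using r by (simp add: z_def)
  qed
  have "(\<lambda>n. of_real (k n) * R0_transform n (of_nat (n + 2) * z i j)) \<longlonglongrightarrow> R0_limit (z i j)" for i j
    using R0_transform_scaled_limit[OF z] by (simp only: k_def of_real_divide of_real_of_nat_eq of_real_fact)
  then have lim: "(\<lambda>n. Re (S n)) \<longlonglongrightarrow> Re ?L"
    unfolding S_def z_def[symmetric] by (intro tendsto_intros)
  have "Re (S n) \<ge> 0" if cm: "completely_monotonic_on {0<..} (G n)" for n
  proof -
    let ?m = "real (n + 2)"
    \<comment> \<open>Dilation by n + 2 maps the circle with centre a and radius r to one that still
      lies in the half-plane, with the same angles, so the kernel inequality for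
      \<open>R0_transform n\<close> applies at the dilated points.\<close>
    have "0 \<le> Re (\<Sum>i\<in>I. \<Sum>j\<in>I. c i * cnj (c j) *
        R0_transform n (of_real (?m * a) - of_real (?m * r) * cis (t i - t j)))"
      using r by (intro completely_monotonic_positive_definite[OF cm holomorphic_R0_transform])
        (auto simp: R0_transform_of_real G simp del: of_nat_add)
    also have "(\<lambda>i j. of_real (?m * a) - of_real (?m * r) * cis (t i - t j)) = (\<lambda>i j. of_nat (n + 2) * z i j)"
      by (simp add: z_def right_diff_distrib mult.assoc fun_eq_iff)
    finally have "0 \<le> k n * Re (\<Sum>i\<in>I. \<Sum>j\<in>I. c i * cnj (c j) * R0_transform n (of_nat (n + 2) * z i j))"
      by (intro mult_nonneg_nonneg) (auto simp: k_def fun_eq_iff)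
    also have "\<dots> = Re (of_real (k n) * (\<Sum>i\<in>I. \<Sum>j\<in>I. c i * cnj (c j) * R0_transform n (of_nat (n + 2) * z i j)))"
      by (simp only: Re_complex_of_real Im_complex_of_real times_complex.sel mult_zero_left diff_zero)
    also have "\<dots> = Re (S n)"
      by (simp only: S_def sum_distrib_left) (simp only: mult_ac)
    finally show ?thesis .
  qed
  then have "\<exists>\<^sub>F n in sequentially. Re (S n) \<ge> 0"
    using freq by (auto elim: frequently_elim1)
  \<comment> \<open>The whole sequence \<open>Re (S n)\<close> converges, so a negative limit would
    make it eventually negative; nonnegativity for infinitely many n excludes this.\<close>
  then show ?thesis
    using order_tendstoD(2)[OF lim, of 0] by (force simp: frequently_def not_le)
qed

lemma R0_limit_positive_definite:
  assumes freq: "\<exists>\<^sub>F n in sequentially. completely_monotonic_on {0<..} (G n)"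
    and G: "\<And>n x. x > 0 \<Longrightarrow> G n x = R0_transform n x"
    and y: "y > 0"
  shows "0 \<le> Re (\<Sum>i\<in>I. \<Sum>j\<in>I. c i * cnj (c j) * R0_limit (of_real y - \<i> * of_real (t i - t j)))"
proof -
  have "((\<lambda>a. R0_limit (of_real a - of_real (a - y) * cis (s / a))) \<longlongrightarrow> R0_limit (of_real y - \<i> * of_real s)) at_top" for s
  proof (rule isCont_tendsto_compose[OF isCont_R0_limit tendsto_rotation])
    have "Re (of_real y - \<i> * of_real s) > 0" using y by simp
    then show "of_real y - \<i> * of_real s \<noteq> 0" "exp (- 1 / (of_real y - \<i> * of_real s)) \<noteq> 1"
      by (force, rule exp_inverse_neq_1)
  qed
  then have lim: "((\<lambda>a. Re (\<Sum>i\<in>I. \<Sum>j\<in>I. c i * cnj (c j) *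
      R0_limit (of_real a - of_real (a - y) * cis ((t i - t j) / a)))) \<longlongrightarrow>
      Re (\<Sum>i\<in>I. \<Sum>j\<in>I. c i * cnj (c j) * R0_limit (of_real y - \<i> * of_real (t i - t j)))) at_top"
    by (intro tendsto_intros)
  have "eventually (\<lambda>a. 0 \<le> Re (\<Sum>i\<in>I. \<Sum>j\<in>I. c i * cnj (c j) *
      R0_limit (of_real a - of_real (a - y) * cis ((t i - t j) / a)))) at_top"
    using eventually_ge_at_top[of y]
  proof eventually_elim
    case (elim a)
    then show ?case
      using R0_limit_positive_definite_circle[OF freq G, where a = a and r = "a - y" and t = "\<lambda>i. t i / a"] y
      by (simp add: diff_divide_distrib)
  qed
  with lim show ?thesis
    by (intro tendsto_lowerbound[OF lim]) auto
qed

(* The limit, as y tends to 0 from the right, of the real part of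
   y cis(d pi/24) R0_limit (y - i d/(24 pi)): the poles i/(2 pi k) of R0_limit lie on the lattice
   i Z/(24 pi) when k divides 12, and the rotations cis(d pi/24) are chosen to line up the residues
   at k = 1, 2, 3, 4. *)
definition boundary_coef :: "int \<Rightarrow> real" where
  "boundary_coef d = (if d = 0 then 1 / 2 else if d dvd 12 then - (d / (24 * pi)) * sin (d * pi / 24) else 0)"

section \<open>The boundary kernel tested against a character\<close>

text \<open>The exponent is -2 pi i (12/d), so the exponential is 1 exactly when 12/d is an
  integer.\<close>

lemma exp_eq_1_iff_dvd:
  assumes "d \<noteq> 0"
  shows "exp (- \<i> / of_real (real_of_int d / (24 * pi))) = 1 \<longleftrightarrow> d dvd 12"
proof -
  have "- \<i> / of_real (real_of_int d / (24 * pi)) = \<i> * of_real (- 24 * pi / real_of_int d)"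
    using assms by simp
  then have "exp (- \<i> / of_real (real_of_int d / (24 * pi))) = 1 \<longleftrightarrow>
      (\<exists>n. - 24 * pi / real_of_int d = of_int (2 * n) * pi)"
    by (simp add: exp_eq_1)
  also have "\<dots> \<longleftrightarrow> (\<exists>n. real_of_int 12 = real_of_int (- n * d))"
  proof (intro ex_cong1)
    fix n
    have "- 24 * pi / real_of_int d = of_int (2 * n) * pi \<longleftrightarrow> (2 * pi) * 12 = (2 * pi) * real_of_int (- n * d)"
      using assms by (auto simp: field_simps)
    also have "\<dots> \<longleftrightarrow> real_of_int 12 = real_of_int (- n * d)"
      by (subst mult_cancel_left) simp
    finally show "- 24 * pi / real_of_int d = of_int (2 * n) * pi \<longleftrightarrow> real_of_int 12 = real_of_int (- n * d)" .
  qed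
  also have "\<dots> \<longleftrightarrow> (\<exists>n. 12 = d * (- n))"
    unfolding of_int_eq_iff by (simp add: mult.commute)
  also have "\<dots> \<longleftrightarrow> d dvd 12"
    unfolding dvd_def by (metis minus_minus)
  finally show ?thesis .
qed

lemma boundary_coef_limit:
  "((\<lambda>y. Re (of_real y * (cis (d * pi / 24) * R0_limit (of_real y - \<i> * of_real (real_of_int d / (24 * pi))))))
      \<longlongrightarrow> boundary_coef d) (at_right 0)"
proof -
  let ?s = "real_of_int d / (24 * pi)"
  define L where "L = (if d = 0 then 1 / 2 else if d dvd 12 then \<i> * of_real ?s else 0)"
  have "((\<lambda>y. of_real y * R0_limit (of_real y - \<i> * of_real ?s)) \<longlongrightarrow> L) (at_right 0)"
    using R0_limit_at_0 R0_limit_at_pole[of ?s] R0_limit_at_regular_point[of ?s] exp_eq_1_iff_dvd[of d]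
    by (auto simp: L_def)
  then have "((\<lambda>y. Re (cis (d * pi / 24) * (of_real y * R0_limit (of_real y - \<i> * of_real ?s)))) \<longlongrightarrow>
      Re (cis (d * pi / 24) * L)) (at_right 0)"
    by (intro tendsto_intros)
  moreover have "Re (cis (d * pi / 24) * L) = boundary_coef d"
    by (simp add: L_def boundary_coef_def)
  ultimately show ?thesis
    by (simp only: mult.left_commute)
qed

lemma boundary_coef_sum_nonneg:
  assumes freq: "\<exists>\<^sub>F n in sequentially. completely_monotonic_on {0<..} (G n)"
    and G: "\<And>n x. x > 0 \<Longrightarrow> G n x = R0_transform n x"
  shows "0 \<le> (\<Sum>i<N. \<Sum>j<N. boundary_coef (int i - int j))"
proof -
  let ?f = "\<lambda>y d. cis (real_of_int d * pi / 24) * R0_limit (of_real y - \<i> * of_real (real_of_int d / (24 * pi)))"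
  have lim: "((\<lambda>y. \<Sum>i<N. \<Sum>j<N. Re (of_real y * ?f y (int i - int j))) \<longlongrightarrow>
      (\<Sum>i<N. \<Sum>j<N. boundary_coef (int i - int j))) (at_right 0)"
    by (intro tendsto_sum boundary_coef_limit)
  have "eventually (\<lambda>y. 0 \<le> (\<Sum>i<N. \<Sum>j<N. Re (of_real y * ?f y (int i - int j)))) (at_right 0)"
    using eventually_at_right_less[of 0]
  proof eventually_elim
    case (elim y)
    have eq: "cis (real i * pi / 24) * cnj (cis (real j * pi / 24)) *
        R0_limit (of_real y - \<i> * of_real (real i / (24 * pi) - real j / (24 * pi))) = ?f y (int i - int j)" for i j
      by (simp add: cis_cnj cis_mult diff_divide_distrib left_diff_distrib)
    \<comment> \<open>The positive factor y preserves the sign and keeps the values near the poles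
      bounded as y tends to 0.\<close>
    have "0 \<le> y * Re (\<Sum>i<N. \<Sum>j<N. ?f y (int i - int j))"
      using R0_limit_positive_definite[OF freq G elim, where I = "{..<N}" and c = "\<lambda>i. cis (real i * pi / 24)"
          and t = "\<lambda>i. real i / (24 * pi)"] elim
      unfolding eq by (intro mult_nonneg_nonneg) auto
    also have "\<dots> = Re (of_real y * (\<Sum>i<N. \<Sum>j<N. ?f y (int i - int j)))"
      by (simp only: Re_complex_of_real Im_complex_of_real times_complex.sel mult_zero_left diff_zero)
    also have "\<dots> = (\<Sum>i<N. \<Sum>j<N. Re (of_real y * ?f y (int i - int j)))"
      by (simp only: sum_distrib_left Re_sum)
    finally show ?case .
  qed
  then show ?thesis
    by (intro tendsto_lowerbound[OF lim]) auto
qed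

section \<open>Numerical contradiction\<close>

text \<open>Otherwise 8/15 = (16/5)/6 would be at most pi/6, forcing sin(8/15) \<le> 1/2; but the
  cubic Taylor polynomial with its error bound puts sin(8/15) above 1/2.\<close>

lemma pi_less_16_5: "pi < 16 / 5"
proof (rule ccontr)
  assume "\<not> pi < 16 / 5"
  then have "sin (8 / 15) \<le> sin (pi / 6)"
    by (intro sin_monotone_2pi_le) auto
  then have "sin (8 / 15) \<le> (1 / 2 :: real)"
    by (simp add: sin_30)
  moreover have "(\<Sum>m<5. sin_coeff m * (8 / 15) ^ m) = (8 / 15 - (8 / 15) ^ 3 / 6 :: real)"
  proof -
    have "sin_coeff 3 = - 1 / 6" "sin_coeff 4 = 0"
      by (simp_all add: sin_coeff_def fact_numeral)
    then show ?thesis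
      by (simp add: lessThan_nat_numeral lessThan_Suc sin_coeff_Suc cos_coeff_Suc numeral_3_eq_3 numeral_2_eq_2)
  qed
  then have "\<bar>sin (8 / 15) - (8 / 15 - (8 / 15) ^ 3 / 6)\<bar> \<le> (8 / 15 :: real) ^ 5 / 120"
    using Maclaurin_sin_bound[of "8 / 15 :: real" 5]
    by (simp add: fact_numeral)
  ultimately show False
    by (simp add: abs_le_iff power_numeral_reduce)
qed

text \<open>All coefficients with d \<ge> 1 are nonpositive: a divisor d of 12 has angle d pi/24 at
  most pi/2. Hence restricting the sum to d = 3, 4, 6, 12 only raises it; these are the poles with k
  = 4, 3, 2, 1, at the angles pi/8, pi/6, pi/4, pi/2.\<close>

lemma boundary_coef_sum_increment:
  assumes "N \<ge> 12"
  shows "(\<Sum>d\<in>{1..N}. boundary_coef (int d)) \<le> boundary_coef 3 + boundary_coef 4 + boundary_coef 6 + boundary_coef 12"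
proof -
  have nonpos: "boundary_coef (int d) \<le> 0" if "d \<ge> 1" for d
  proof (cases "int d dvd 12")
    case True
    then have "d \<le> 12" by (auto dest: zdvd_imp_le)
    then have "0 \<le> sin (real d * pi / 24)" by (intro sin_ge_zero) auto
    then show ?thesis using that True by (simp add: boundary_coef_def)
  qed (use that in \<open>simp add: boundary_coef_def\<close>)
  have "(\<Sum>d\<in>{1..N}. boundary_coef (int d)) \<le> (\<Sum>d\<in>{3, 4, 6, 12}. boundary_coef (int d))"
    using assms sum_mono2[of "{1..N}" "{3, 4, 6, 12}" "\<lambda>d. - boundary_coef (int d)"] nonpos
    by (simp add: sum_negf)
  then show ?thesis by simp
qed

text \<open>Multiplied by 2 pi, the claim is pi < 2 (1 + sqrt 2 / 4 + 1/6 + s/4) with s = sin(pi/8),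
  and the right side exceeds 16/5.\<close>

lemma boundary_coef_negative: "boundary_coef 0 + 2 * (boundary_coef 3 + boundary_coef 4 + boundary_coef 6 + boundary_coef 12) < 0"
proof -
  define s where "s = sin (pi / 8)"
  \<comment> \<open>The lower bound enters the final estimate directly; the upper bound yields s
    \<ge> 0.38 through the half-angle identity. Together they give about 3.223 > 16/5.\<close>
  have "sqrt 2 \<ge> 14 / 10" "sqrt 2 \<le> 1415 / 1000"
    by (rule real_le_rsqrt, simp add: power2_eq_square) (rule real_le_lsqrt, simp_all add: power2_eq_square)
  moreover have "s \<ge> 38 / 100"
  proof (rule power2_le_imp_le)
    have "cos (2 * (pi / 8)) = 1 - 2 * s\<^sup>2"
      unfolding s_def by (rule cos_double_sin)
    then have "sqrt 2 / 2 = 1 - 2 * s\<^sup>2"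
      by (simp add: cos_45)
    with \<open>sqrt 2 \<le> 1415 / 1000\<close> show "(38 / 100)\<^sup>2 \<le> s\<^sup>2"
      by (simp add: power2_eq_square)
    show "0 \<le> s"
      unfolding s_def by (intro sin_ge_zero) auto
  qed
  ultimately have "pi - 2 * (1 + sqrt 2 / 4 + 1 / 6 + s / 4) < 0"
    using pi_less_16_5 by simp
  then have neg: "(pi - 2 * (1 + sqrt 2 / 4 + 1 / 6 + s / 4)) / (2 * pi) < 0"
    by (intro divide_neg_pos) auto
  have c: "boundary_coef 3 = - s / (8 * pi)" "boundary_coef 4 = - 1 / (12 * pi)"
      "boundary_coef 6 = - sqrt 2 / (8 * pi)" "boundary_coef 12 = - 1 / (2 * pi)" "boundary_coef 0 = 1 / 2"
    by (simp_all add: boundary_coef_def s_def sin_30 sin_45)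
  have "boundary_coef 0 + 2 * (boundary_coef 3 + boundary_coef 4 + boundary_coef 6 + boundary_coef 12) =
      (pi - 2 * (1 + sqrt 2 / 4 + 1 / 6 + s / 4)) / (2 * pi)"
    unfolding c by (simp add: field_simps)
  with neg show ?thesis
    by simp
qed

text \<open>Enlarging N by one adds a diagonal entry and, by symmetry, twice the sum of the
  coefficients for d from 1 to N. From N = 12 on this increment is at most a fixed negative number,
  so the double sums fall below 0.\<close>

lemma boundary_coef_sum_negative: "\<exists>N. (\<Sum>i<N. \<Sum>j<N. boundary_coef (int i - int j)) < 0"
proof -
  define T where "T N = (\<Sum>i<N. \<Sum>j<N. boundary_coef (int i - int j))" for N
  define \<delta> where "\<delta> = - (boundary_coef 0 + 2 * (boundary_coef 3 + boundary_coef 4 + boundary_coef 6 + boundary_coef 12))"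
  have sym: "boundary_coef (- d) = boundary_coef d" for d
    by (simp add: boundary_coef_def)
  have step: "T (Suc N) = T N + boundary_coef 0 + 2 * (\<Sum>d\<in>{1..N}. boundary_coef (int d))" for N
  proof -
    have 1: "(\<Sum>j<N. boundary_coef (int N - int j)) = (\<Sum>d\<in>{1..N}. boundary_coef (int d))"
      by (rule sum.reindex_bij_witness[of _ "\<lambda>d. N - d" "\<lambda>j. N - j"]) (auto simp: of_nat_diff)
    have 2: "(\<Sum>j<N. boundary_coef (int j - int N)) = (\<Sum>j<N. boundary_coef (int N - int j))"
      using sym by (intro sum.cong refl) (metis minus_diff_eq)
    show ?thesis
      unfolding T_def by (simp add: sum.distrib 1 2)
  qed
  have T: "T (12 + k) \<le> T 12 - real k * \<delta>" for k
  proof (induction k)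
    case (Suc k)
    have "T (Suc (12 + k)) \<le> T (12 + k) - \<delta>"
      using step[of "12 + k"] boundary_coef_sum_increment[of "12 + k"] by (simp add: \<delta>_def)
    with Suc show ?case by (simp add: algebra_simps)
  qed simp
  have "\<delta> > 0"
    using boundary_coef_negative by (simp add: \<delta>_def)
  then obtain k where "T 12 < real k * \<delta>"
    using reals_Archimedean3 by blast
  with T[of k] show ?thesis
    by (intro exI[of _ "12 + k"]) (simp add: T_def)
qed

theorem proposition1p2:
  shows "\<exists>m0::nat. \<forall>m\<ge>m0.
    \<not> completely_monotonic_on {0<..}
        (\<lambda>x::real. (-1) ^ m * x powi (int m - 1) * (deriv ^^ m) R0 x)"
proof (rule ccontr)
  let ?G = "\<lambda>m x::real. (-1) ^ m * x powi (int m - 1) * (deriv ^^ m) R0 x"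
  assume neg: "\<not> ?thesis"
  \<comment> \<open>The negated claim gives infinitely many m; those with m \<ge> N + 2 are written
    as m = n + 2 to match the indexing of \<open>R0_transform\<close>.\<close>
  have "\<exists>\<^sub>F n in sequentially. completely_monotonic_on {0<..} (?G (n + 2))"
    unfolding frequently_sequentially
  proof
    fix N
    from neg obtain m where m: "m \<ge> N + 2" "completely_monotonic_on {0<..} (?G m)"
      by blast
    then have "m - 2 \<ge> N" "m - 2 + 2 = m" by auto
    with m show "\<exists>n\<ge>N. completely_monotonic_on {0<..} (?G (n + 2))"
      by metis
  qed
  from boundary_coef_sum_nonneg[OF this R0_transform_eq] boundary_coef_sum_negative show False
    by (meson not_le)
qed

end
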